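(* Let $a,b\ge1$ be even integers. Then the Horadam cube $\Pi^{a,b}_n$ is Hamiltonian for every $n\ge3$.
   Context: For integers $a,b\ge1$ and $n\ge 0$, $\mathcal S^{a,b}_n$ is the set of all strings of length $n$ over the alphabet $\{0,1,\dots,a+b-1\}$ in which every letter from $\{a,\dots,a+b-1\}$ appears only immediately after a letter $0$. The Horadam cube $\Pi^{a,b}_n$ is the simple graph with vertex set $\mathcal S^{a,b}_n$ in which $x_1\cdots x_n$ and $y_1\cdots y_n$ are adjacent if and only if $\sum_{i=1}^n|x_i-y_i|=1$. A graph is Hamiltonian if it contains a cycle visiting each vertex exactly once. *)

theory Defs
  imports "Graph_Theory.Graph_Theory"
begin

definition horadam_strings :: "nat \<Rightarrow> nat \<Rightarrow> nat \<Rightarrow> nat list set" where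
  "horadam_strings a b n =
     {x. length x = n \<and> set x \<subseteq> {0..<a + b} \<and>
         (\<forall>i<n. x ! i \<in> {a..<a + b} \<longrightarrow> i > 0 \<and> x ! (i - 1) = 0)}"

(* Undirected graphs are symmetric digraphs: each edge is represented by both of its arcs. *)
definition horadam_cube :: "nat \<Rightarrow> nat \<Rightarrow> nat \<Rightarrow> nat list pair_pre_digraph" where
  "horadam_cube a b n =
     \<lparr> pverts = horadam_strings a b n,
       parcs = {(x, y). x \<in> horadam_strings a b n \<and> y \<in> horadam_strings a b n \<and>
                        (\<Sum>i<n. \<bar>int (x ! i) - int (y ! i)\<bar>) = 1} \<rparr>"

lemma finite_horadam_strings: "finite (horadam_strings a b n)"
proof (rule finite_subset)
  show "horadam_strings a b n \<subseteq> {x. set x \<subseteq> {0..<a + b} \<and> length x = n}"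
    by (auto simp: horadam_strings_def)
qed (simp add: finite_lists_length_eq)

lemma pair_graph_horadam_cube: "pair_graph (horadam_cube a b n)"
proof
  show "finite (parcs (horadam_cube a b n))"
    by (rule finite_subset[of _ "horadam_strings a b n \<times> horadam_strings a b n"])
       (auto simp: horadam_cube_def finite_horadam_strings)
  show "symmetric (with_proj (horadam_cube a b n))"
    by (auto simp: symmetric_def horadam_cube_def abs_minus_commute intro!: symI)
qed (auto simp: horadam_cube_def finite_horadam_strings)

(* A closed walk u, v, u along one edge counts as a cycle of a symmetric digraph but not of
   the undirected graph, hence the bound on the length. *)
definition hamiltonian :: "('a, 'b) pre_digraph \<Rightarrow> bool" where
  "hamiltonian G \<longleftrightarrow>
     (\<exists>u p. pre_digraph.cycle G p \<and> pre_digraph.awalk G u p u \<and> length p \<ge> 3 \<and>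
            set (pre_digraph.awalk_verts G u p) = verts G)"

end

theory Submission
  imports Defs
begin

text \<open>By induction on \<open>n \<ge> 1\<close>, there are Hamiltonian paths \<open>P\<close> for length \<open>n\<close> and \<open>Q\<close> for length
  \<open>n + 1\<close> such that \<open>Q\<close> contains the copy of \<open>P\<close> with the letter \<open>a - 1\<close> put in front. The strings of
  length \<open>n + 2\<close> split into the strings \<open>i w\<close> with \<open>i < a\<close>, spanned by an \<open>a \<times> |Q|\<close> grid, and the
  strings \<open>0 (a + i) w\<close> with \<open>i < b\<close>, spanned by a \<open>b \<times> |P|\<close> grid. Since \<open>a\<close> and \<open>b\<close> are even, both
  grids have Hamiltonian cycles. If \<open>u v\<close> is an edge of \<open>P\<close>, these can be chosen through the parallel
  edges \<open>0 (a - 1) u\<close>, \<open>0 (a - 1) v\<close> and \<open>0 a u\<close>, \<open>0 a v\<close>, where they are joined to a Hamiltonian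
  cycle for length \<open>n + 2\<close>. Opened at one of the two joining edges, it contains a copy of the
  reversed \<open>Q\<close> in the row \<open>a - 1\<close>, which restores the invariant.\<close>

section \<open>Hamiltonian paths in grids\<close>

text \<open>Boustrophedon order of a grid: with every second row reversed, each row ends in the
  column where the next one begins.\<close>

primrec snake :: "(nat \<Rightarrow> 'a \<Rightarrow> 'b) \<Rightarrow> 'a list \<Rightarrow> nat \<Rightarrow> 'b list" where
  "snake f xs 0 = []"
| "snake f xs (Suc k) = snake f xs k @ map (f k) (if even k then xs else rev xs)"

lemma set_snake: "set (snake f xs k) = (\<Union>i<k. f i ` set xs)"
  by (induction k) (auto simp: lessThan_Suc)

lemma snake_eq_Nil_iff: "xs \<noteq> [] \<Longrightarrow> snake f xs k = [] \<longleftrightarrow> k = 0"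
  by (induction k) auto

lemma hd_snake: "xs \<noteq> [] \<Longrightarrow> hd (snake f xs (Suc k)) = f 0 (hd xs)"
  by (induction k) (auto simp: hd_append hd_map snake_eq_Nil_iff)

lemma last_snake:
  "xs \<noteq> [] \<Longrightarrow> last (snake f xs (Suc k)) = f k (if even k then last xs else hd xs)"
  by (auto simp: last_map last_rev)

lemma distinct_snake:
  assumes "\<And>i j x y. f i x = f j y \<Longrightarrow> i = j \<and> x = y" and "distinct xs"
  shows "distinct (snake f xs k)"
proof (induction k)
  case (Suc k)
  have "inj_on (f k) (set xs)" using assms(1) by (auto intro: inj_onI)
  then show ?case using Suc assms by (auto simp: distinct_map set_snake)
qed simp

lemma successively_rev_sym: "symp R \<Longrightarrow> successively R (rev xs) \<longleftrightarrow> successively R xs"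
  by (auto simp: successively_rev symp_def elim!: successively_mono)

lemma successively_mapI:
  "successively R xs \<Longrightarrow> (\<And>x y. R x y \<Longrightarrow> R' (f x) (f y)) \<Longrightarrow> successively R' (map f xs)"
  by (auto simp: successively_map elim: successively_mono)

lemma successively_upt: "successively (\<lambda>i j. j = Suc i) [0..<k]"
proof (induction k)
  case (Suc k)
  then show ?case by (cases k) (auto simp: successively_append_iff)
qed simp

lemma successively_snake:
  assumes row: "\<And>i x y. R x y \<Longrightarrow> R' (f i x) (f i y)"
    and col: "\<And>i x. R' (f i x) (f (Suc i) x)"
    and "symp R" and "xs \<noteq> []" and "successively R xs"
  shows "successively R' (snake f xs k)"
proof (induction k)
  case (Suc k)
  have r: "successively R' (map (f k) (if even k then xs else rev xs))"
    by (rule successively_mapI[where R=R])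
      (use assms in \<open>auto simp: successively_rev_sym simp del: successively_rev\<close>)
  show ?case
  proof (cases k)
    case (Suc j)
    have "R' (last (snake f xs k)) (hd (map (f k) (if even k then xs else rev xs)))"
      unfolding Suc using \<open>xs \<noteq> []\<close> col by (subst last_snake) (auto simp: hd_map hd_rev)
    then show ?thesis using r Suc.IH by (auto simp: successively_append_iff)
  qed (use r in simp)
qed simp

text \<open>With the first column \<open>q\<close> set aside, snake through the rows \<open>1, \<dots>, k - 1\<close> and come back
  along the first column: together with row \<open>0\<close> this is a Hamiltonian cycle of the grid. It
  uses all edges of row \<open>0\<close>, so it can be opened there at any of them, and, as \<open>k\<close> is even, all
  edges of row \<open>k - 1\<close>.\<close>

lemma grid_path:
  fixes f :: "nat \<Rightarrow> 'a \<Rightarrow> 'b"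
  assumes row: "\<And>i x y. R x y \<Longrightarrow> R' (f i x) (f i y)"
    and col: "\<And>i x. R' (f i x) (f (Suc i) x)"
    and inj: "\<And>i j x y. f i x = f j y \<Longrightarrow> i = j \<and> x = y"
    and sym: "symp R" "symp R'"
    and k: "even k" "k > 0"
    and Q: "Q = ys @ x # y # zs" "distinct Q" "successively R Q"
  obtains A B where
    "distinct (A @ map (f (k - 1)) (rev Q) @ B)"
    "successively R' (A @ map (f (k - 1)) (rev Q) @ B)"
    "set (A @ map (f (k - 1)) (rev Q) @ B) = (\<Union>i<k. f i ` set Q)"
    "hd (A @ map (f (k - 1)) (rev Q) @ B) = f 0 y"
    "last (A @ map (f (k - 1)) (rev Q) @ B) = f 0 x"
proof -
  obtain m where m: "k = Suc (Suc m)" "even m"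
    using that[of "k - 2"] k by (cases k rule: nat.exhaust; cases "k - 1") auto
  \<comment> \<open>Row 0 reads \<open>q\<close>, \<open>s\<close>, \<open>y\<close>,
    \<open>zs\<close>. If \<open>ys\<close> is empty, then \<open>x\<close> is \<open>q\<close>
    itself and \<open>s\<close> is empty.\<close>
  obtain q s where qs: "ys @ [x] = q # s" by (cases ys) auto
  then have x: "x = last (q # s)" by (metis last_snoc)
  define t where "t = s @ y # zs"
  have Qt: "Q = q # t" using Q(1) arg_cong[OF qs, of "\<lambda>l. l @ y # zs"] by (simp add: t_def)
  \<comment> \<open>Row 0 will be left at \<open>last t\<close>, hence \<open>rev t\<close>. The
    number \<open>Suc m\<close> of remaining rows is odd because \<open>k\<close> is even, so the
    snake ends at \<open>hd t\<close>, next to the column of \<open>q\<close>.\<close>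
  define S where "S = snake (\<lambda>i. f (Suc i)) (rev t) (Suc m)"
  define C where "C = map (\<lambda>i. f i q) (rev [0..<k])"
  \<comment> \<open>From \<open>y\<close> to the end of row 0, through the snake, back along the
    first column to \<open>f 0 q\<close>, and on to \<open>x\<close>.\<close>
  define N where "N = map (f 0) (y # zs) @ S @ C @ map (f 0) s"
  have t: "t \<noteq> []" "distinct t" "q \<notin> set t" "successively R t" "R q (hd t)"
    using Q Qt by (auto simp: t_def successively_Cons)
  have sR: "successively R (y # zs)" "successively R s"
    using t(4) by (auto simp: t_def successively_append_iff)
  have S_hd: "hd S = f (Suc 0) (last t)"
    unfolding S_def using t(1) by (subst hd_snake) (auto simp: hd_rev)
  have S_last: "last S = f (Suc m) (hd t)"
    unfolding S_def using t(1) m(2) by (subst last_snake) (auto simp: last_rev)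
  have S_ne: "S \<noteq> []" unfolding S_def using t(1) by (subst snake_eq_Nil_iff) auto
  have C_ne: "C \<noteq> []" by (simp add: C_def m)
  have C_hd: "hd C = f (Suc m) q" by (simp add: C_def m)
  have C_last: "last C = f 0 q" unfolding C_def m(1) by (simp add: last_map last_rev)
  have inj': "f i u = f j v \<longleftrightarrow> i = j \<and> u = v" for i j u v using inj by blast
  have S_set: "set S = (\<Union>i<Suc m. f (Suc i) ` set t)" by (simp only: S_def set_snake set_rev)
  have C_set: "set C = (\<lambda>i. f i q) ` {..<k}" by (auto simp: C_def)
  have row_path: "successively R' (map (f i) xs)" if "successively R xs" for i xs
    using that row by (rule successively_mapI)
  have "successively R' S"
    unfolding S_def by (rule successively_snake[where R=R])
      (use row col sym t in \<open>auto simp: successively_rev_sym simp del: successively_rev\<close>)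
  moreover have "successively R' C"
    using successively_mapI[OF successively_upt, of R' "\<lambda>i. f i q" k] col sym(2)
    by (auto simp: C_def rev_map[symmetric] successively_rev_sym simp del: successively_rev)
  moreover have "last (map (f 0) (y # zs)) = f 0 (last t)"
    by (simp add: t_def last_map)
  moreover have "R' (f (Suc m) (hd t)) (f (Suc m) q)"
    using t(5) row sym by (auto dest: sympD)
  moreover have "s = [] \<or> R' (f 0 q) (hd (map (f 0) s))"
    using t(5) row by (cases s) (auto simp: t_def)
  ultimately have "successively R' N"
    unfolding N_def using row_path[OF sR(1), of 0] row_path[OF sR(2), of 0] S_ne C_ne
    by (auto simp: successively_append_iff S_hd S_last C_hd C_last hd_map col hd_append
        simp del: list.map(2))
  moreover have "distinct N"
  proof -
    have "distinct S" unfolding S_def by (rule distinct_snake) (use t inj in auto)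
    moreover have "distinct C" by (auto simp: C_def distinct_map inj_on_def inj')
    ultimately show ?thesis unfolding N_def using t(2,3)
      by (auto simp: S_set C_set distinct_map inj_on_def inj' t_def)
  qed
  moreover have "set N = (\<Union>i<k. f i ` set Q)"
    unfolding N_def Qt m(1)
    by (auto simp: S_set C_set m(1) t_def lessThan_Suc_eq_insert_0)
  moreover have "hd N = f 0 y" by (simp add: N_def)
  moreover have "last N = f 0 x" by (simp add: N_def C_last C_ne x last_map)
  \<comment> \<open>The last row of the snake runs along \<open>rev t\<close>, and the column
    continues it at \<open>q\<close>; together they traverse \<open>rev Q\<close>.\<close>
  moreover have "N = (map (f 0) (y # zs) @ snake (\<lambda>i. f (Suc i)) (rev t) m) @
      map (f (k - 1)) (rev Q) @ (map (\<lambda>i. f i q) (rev [0..<Suc m]) @ map (f 0) s)"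
    using m by (simp add: N_def S_def C_def Qt)
  ultimately show ?thesis using that by metis
qed

section \<open>Horadam strings\<close>

definition adj :: "nat list \<Rightarrow> nat list \<Rightarrow> bool" where
  "adj x y \<longleftrightarrow> length x = length y \<and> (\<Sum>i<length x. \<bar>int (x ! i) - int (y ! i)\<bar>) = 1"

lemma symp_adj: "symp adj"
  by (auto simp: symp_def adj_def abs_minus_commute)

lemma adj_Cons [simp]: "adj (i # x) (i # y) \<longleftrightarrow> adj x y"
  by (auto simp: adj_def sum.lessThan_Suc_shift simp del: sum.lessThan_Suc)

lemma adj_Suc [simp]: "adj (i # x) (Suc i # x)"
  by (auto simp: adj_def sum.lessThan_Suc_shift simp del: sum.lessThan_Suc)

text \<open>The argument \<open>p\<close> is the letter preceding the string.\<close>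

fun valid :: "nat \<Rightarrow> nat \<Rightarrow> nat \<Rightarrow> nat list \<Rightarrow> bool" where
  "valid a b p [] \<longleftrightarrow> True"
| "valid a b p (x # xs) \<longleftrightarrow> x < a + b \<and> (a \<le> x \<longrightarrow> p = 0) \<and> valid a b x xs"

lemma valid_iff:
  "valid a b p x \<longleftrightarrow> set x \<subseteq> {0..<a + b} \<and> (\<forall>i<length x. a \<le> x ! i \<longrightarrow> (p # x) ! i = 0)"
  by (induction x arbitrary: p) (auto simp: All_less_Suc2)

text \<open>The fictitious preceding letter 1, like any nonzero letter, bars the letters from
  \<open>a\<close> on at the first position.\<close>

lemma horadam_strings_eq: "horadam_strings a b n = {x. length x = n \<and> valid a b 1 x}"
proof -
  have "(x ! i \<in> {a..<a + b} \<longrightarrow> i > 0 \<and> x ! (i - 1) = 0) \<longleftrightarrow>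
      (a \<le> x ! i \<longrightarrow> (1 # x) ! i = 0)" if "set x \<subseteq> {0..<a + b}" "i < length x" for x i
  proof -
    have "x ! i < a + b" using that nth_mem by fastforce
    then show ?thesis by (cases i) auto
  qed
  then show ?thesis
    unfolding horadam_strings_def valid_iff by (intro Collect_cong) metis
qed

lemma valid_pos: "p > 0 \<Longrightarrow> valid a b p x \<longleftrightarrow> valid a b 1 x"
  by (cases x) auto

lemma horadam_strings_0: "horadam_strings a b 0 = {[]}"
  by (auto simp: horadam_strings_eq)

lemma horadam_strings_1: "horadam_strings a b (Suc 0) = (\<lambda>i. [i]) ` {..<a}"
  by (auto simp: horadam_strings_eq length_Suc_conv)

text \<open>Split by whether the second letter is below \<open>a\<close>. If it is not, the first
  letter must be 0, and what follows the nonzero letter \<open>a + i\<close> is constrained as at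
  the start of a string.\<close>

lemma horadam_strings_Suc_Suc:
  assumes "a > 0"
  shows "horadam_strings a b (Suc (Suc n)) =
    (\<Union>i<a. (#) i ` horadam_strings a b (Suc n)) \<union>
    (\<Union>i<b. (\<lambda>w. 0 # (a + i) # w) ` horadam_strings a b n)" (is "?L = ?R")
proof (intro equalityI subsetI)
  fix x assume "x \<in> ?L"
  then obtain c d w where x: "x = c # d # w" "length w = n" "valid a b 1 (c # d # w)"
    by (auto simp: horadam_strings_eq length_Suc_conv)
  show "x \<in> ?R"
  proof (cases "d < a")
    case True
    then have "d # w \<in> horadam_strings a b (Suc n)" "c < a"
      using x assms by (auto simp: horadam_strings_eq)
    then show ?thesis using x(1) by auto
  next
    case False
    then obtain e where e: "d = a + e" using le_Suc_ex by (metis not_less)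
    then have "c = 0" "e < b" "w \<in> horadam_strings a b n"
      using x assms by (auto simp: horadam_strings_eq valid_pos[of "a + e"])
    then show ?thesis using x(1) e by auto
  qed
next
  fix x assume "x \<in> ?R"
  then consider i w where "x = i # w" "i < a" "w \<in> horadam_strings a b (Suc n)"
    | i w where "x = 0 # (a + i) # w" "i < b" "w \<in> horadam_strings a b n" by auto
  then show "x \<in> ?L"
  proof cases
    case 1
    then show ?thesis by (cases "i = 0")
      (auto simp: horadam_strings_eq length_Suc_conv valid_pos[of i])
  next
    case 2
    then show ?thesis using assms by (auto simp: horadam_strings_eq valid_pos[of "a + i"])
  qed
qed

section \<open>Linked Hamiltonian paths for consecutive lengths\<close>

definition ham_path :: "nat \<Rightarrow> nat \<Rightarrow> nat \<Rightarrow> nat list list \<Rightarrow> bool" where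
  "ham_path a b n p \<longleftrightarrow> distinct p \<and> successively adj p \<and> set p = horadam_strings a b n"

text \<open>The block in \<open>q\<close> turns every edge of \<open>p\<close> into an edge of
  \<open>q\<close>, and the length bound provides one. The letter is \<open>a - 1\<close> because it
  is the neighbour of \<open>a\<close>, the least letter that needs a 0 before it.\<close>

definition linked_paths :: "nat \<Rightarrow> nat \<Rightarrow> nat \<Rightarrow> nat list list \<Rightarrow> nat list list \<Rightarrow> bool" where
  "linked_paths a b n p q \<longleftrightarrow> ham_path a b n p \<and> length p \<ge> 2 \<and> ham_path a b (Suc n) q \<and>
     (\<exists>A B. q = A @ map ((#) (a - 1)) p @ B)"

lemma linked_paths_1:
  assumes "even a" "a > 0"
  shows "\<exists>p q. linked_paths a b (Suc 0) p q"
proof -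
  obtain m where m: "a = Suc (Suc m)" "even m"
    using that[of "a - 2"] assms by (cases a rule: nat.exhaust; cases "a - 1") auto
  define p where "p = map (\<lambda>i. [i]) [0..<a]"
  \<comment> \<open>\<open>T\<close> is row 0 of the strings of length 2, prolonged by the letters
    from \<open>a\<close> on. Run backwards it ends at 00, next to the start 10 of \<open>S\<close>.
    The rows 1 to \<open>a - 1\<close> are odd in number, so the last one is traversed in the
    direction of \<open>p\<close>.\<close>
  define T where "T = map (\<lambda>i. [0, i]) [0..<a + b]"
  define S where "S = snake (\<lambda>i. (#) (Suc i)) p (Suc m)"
  have p_ne: "p \<noteq> []" and T_ne: "T \<noteq> []" by (auto simp: p_def T_def m)
  have p: "ham_path a b (Suc 0) p"
    unfolding ham_path_def horadam_strings_1
    using successively_mapI[OF successively_upt, of adj "\<lambda>i. [i]" a]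
    by (auto simp: p_def distinct_map inj_on_def)
  have "successively adj T"
    unfolding T_def by (rule successively_mapI[OF successively_upt]) simp
  moreover have "successively adj S"
    unfolding S_def by (rule successively_snake[where R=adj])
      (use p p_ne in \<open>auto simp: ham_path_def symp_adj\<close>)
  moreover have "hd T = [0, 0]" "hd S = [1, 0]"
    using hd_snake[OF p_ne, of "\<lambda>i. (#) (Suc i)" m] m
    by (simp_all add: T_def S_def p_def hd_map del: upt_Suc)
  ultimately have "successively adj (rev T @ S)"
    using T_ne by (auto simp: successively_append_iff successively_rev_sym symp_adj last_rev
        simp del: successively_rev)
  moreover have "distinct (rev T @ S)"
  proof -
    have "distinct S" unfolding S_def
      by (rule distinct_snake) (use p in \<open>auto simp: ham_path_def\<close>)
    then show ?thesis by (auto simp: T_def S_def distinct_map inj_on_def set_snake)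
  qed
  moreover have "set (rev T @ S) = horadam_strings a b (Suc (Suc 0))"
  proof -
    let ?H = "horadam_strings a b (Suc 0)"
    have H: "set p = ?H" using p by (simp add: ham_path_def)
    have "j < a + b \<longleftrightarrow> j < a \<or> (\<exists>i<b. j = a + i)" for j
      by (cases "j < a") (auto simp: not_less le_iff_add)
    then have T: "set T = (#) 0 ` ?H \<union> (\<Union>i<b. {[0, a + i]})"
      unfolding H[symmetric] by (auto simp: T_def p_def)
    have S: "set S = (\<Union>i<Suc m. (#) (Suc i) ` ?H)"
      unfolding S_def set_snake H ..
    have "(\<Union>i<a. (#) i ` ?H) = (#) 0 ` ?H \<union> (\<Union>i<Suc m. (#) (Suc i) ` ?H)"
      unfolding m(1) lessThan_Suc_eq_insert_0[of "Suc m"] UN_insert UN_simps(10) ..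
    then show ?thesis
      unfolding set_append set_rev horadam_strings_Suc_Suc[OF assms(2)] horadam_strings_0 T S
        image_insert image_empty
      by (simp only: Un_ac)
  qed
  ultimately have q: "ham_path a b (Suc (Suc 0)) (rev T @ S)" by (simp add: ham_path_def)
  have "rev T @ S = (rev T @ snake (\<lambda>i. (#) (Suc i)) p m) @ map ((#) (a - 1)) p @ []"
    using m by (simp add: S_def)
  moreover have "length p \<ge> 2" by (simp add: p_def m)
  ultimately have "linked_paths a b (Suc 0) p (rev T @ S)"
    unfolding linked_paths_def using p q by blast
  then show ?thesis by blast
qed

lemma linked_paths_step:
  assumes a: "even a" "a > 0" and b: "even b" "b > 0"
    and pq: "linked_paths a b n p q"
  obtains c where "linked_paths a b (Suc n) (rev q) c" "adj (last c) (hd c)" "length c \<ge> 3"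
proof -
  obtain A B where q: "q = A @ map ((#) (a - 1)) p @ B"
    using pq by (auto simp: linked_paths_def)
  \<comment> \<open>The first edge of \<open>p\<close> serves as the edge along which the two grids
    are joined.\<close>
  obtain u v w where p: "p = [] @ u # v # w"
    using pq by (cases p; cases "tl p") (auto simp: linked_paths_def)
  have q': "q = A @ ((a - 1) # u) # ((a - 1) # v) # (map ((#) (a - 1)) w @ B)"
    using q p by simp
  have hp: "distinct p" "successively adj p" "set p = horadam_strings a b n"
    and hq: "distinct q" "successively adj q" "set q = horadam_strings a b (Suc n)"
    and len: "length p \<ge> 2"
    using pq by (auto simp: linked_paths_def ham_path_def)
  have g: "adj x y \<Longrightarrow> adj (i # x) (i # y)" "adj (i # x) (Suc i # x)"
    "i # x = j # y \<Longrightarrow> i = j \<and> x = y" for i j x y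
    by simp_all
  obtain A1 B1 where g1:
    "distinct (A1 @ map ((#) (a - 1)) (rev q) @ B1)"
    "successively adj (A1 @ map ((#) (a - 1)) (rev q) @ B1)"
    "set (A1 @ map ((#) (a - 1)) (rev q) @ B1) = (\<Union>i<a. (#) i ` set q)"
    "hd (A1 @ map ((#) (a - 1)) (rev q) @ B1) = 0 # (a - 1) # v"
    "last (A1 @ map ((#) (a - 1)) (rev q) @ B1) = 0 # (a - 1) # u"
    by (rule grid_path[of adj adj "(#)", OF g symp_adj symp_adj a q' hq(1,2)])
  define N1 where "N1 = A1 @ map ((#) (a - 1)) (rev q) @ B1"
  note N1 = N1_def g1[folded N1_def]
  have g': "adj x y \<Longrightarrow> adj (0 # (a + i) # x) (0 # (a + i) # y)"
    "adj (0 # (a + i) # x) (0 # (a + Suc i) # x)"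
    "0 # (a + i) # x = 0 # (a + j) # y \<Longrightarrow> i = j \<and> x = y" for i j x y
    by simp_all
  obtain A2 B2 where g2:
    "distinct (A2 @ map (\<lambda>w. 0 # (a + (b - 1)) # w) (rev p) @ B2)"
    "successively adj (A2 @ map (\<lambda>w. 0 # (a + (b - 1)) # w) (rev p) @ B2)"
    "set (A2 @ map (\<lambda>w. 0 # (a + (b - 1)) # w) (rev p) @ B2) =
      (\<Union>i<b. (\<lambda>w. 0 # (a + i) # w) ` set p)"
    "hd (A2 @ map (\<lambda>w. 0 # (a + (b - 1)) # w) (rev p) @ B2) = 0 # (a + 0) # v"
    "last (A2 @ map (\<lambda>w. 0 # (a + (b - 1)) # w) (rev p) @ B2) = 0 # (a + 0) # u"
    by (rule grid_path[of adj adj "\<lambda>i w. 0 # (a + i) # w", OF g' symp_adj symp_adj b p hp(1,2)])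
  define N2 where "N2 = A2 @ map (\<lambda>w. 0 # (a + (b - 1)) # w) (rev p) @ B2"
  note N2 = g2[folded N2_def, unfolded add_0_right]
  have ne: "N1 \<noteq> []" "N2 \<noteq> []" using N1(4) N2(3) p q' a b by auto
  have adj_a: "adj (0 # (a - 1) # x) (0 # a # x)" for x
    using adj_Suc[of "a - 1" x] a by simp
  \<comment> \<open>\<open>N1\<close> leads from \<open>0 (a - 1) v\<close> to
    \<open>0 (a - 1) u\<close>, and \<open>rev N2\<close> from \<open>0 a u\<close> to
    \<open>0 a v\<close>, so both junctions only change the second letter by 1.\<close>
  define c where "c = N1 @ rev N2"
  have "distinct c"
  proof -
    \<comment> \<open>The second letter is below \<open>a\<close> in the first union and at least
      \<open>a\<close> in the second.\<close>
    have "(\<Union>i<a. (#) i ` set q) \<inter> (\<Union>i<b. (\<lambda>w. 0 # (a + i) # w) ` set p) = {}"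
      by (auto simp: hq(3) horadam_strings_eq)
    then show ?thesis using N1(2,4) N2(1,3) by (simp add: c_def)
  qed
  moreover have "successively adj c"
    using N1(3,6) N2(2,5) ne adj_a
    by (simp add: c_def successively_append_iff successively_rev_sym symp_adj hd_rev
        del: successively_rev)
  moreover have "set c = horadam_strings a b (Suc (Suc n))"
    using N1(4) N2(3) horadam_strings_Suc_Suc[OF a(2)] by (simp add: c_def hp hq)
  moreover have "length (rev q) \<ge> 2" using q len by simp
  moreover have "c = A1 @ map ((#) (a - 1)) (rev q) @ (B1 @ rev N2)" by (simp add: c_def N1(1))
  ultimately have "linked_paths a b (Suc n) (rev q) c"
    unfolding linked_paths_def ham_path_def
    using hq by (auto simp: successively_rev_sym symp_adj simp del: successively_rev)
  moreover have "adj (last c) (hd c)"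
    using ne N1(5) N2(4) adj_a symp_adj by (auto simp: c_def last_rev dest: sympD)
  moreover have "length c \<ge> 3"
    using ne(2) len by (cases N2) (auto simp: c_def N1(1) q)
  ultimately show ?thesis using that by blast
qed

section \<open>Hamiltonicity\<close>

lemma vwalk_arcs_walk:
  assumes "xs \<noteq> []"
  shows "pre_digraph.cas (with_proj G) (hd xs) (vwalk_arcs xs) (last xs)"
    and "pre_digraph.awalk_verts (with_proj G) (hd xs) (vwalk_arcs xs) = xs"
  using assms
  by (induction xs rule: vwalk_arcs.induct)
     (auto simp: pre_digraph.cas.simps pre_digraph.awalk_verts.simps)

lemma length_vwalk_arcs: "length (vwalk_arcs xs) = length xs - 1"
  using vwalk_length_simp[of xs] by (simp only: vwalk_length_def)

lemma set_vwalk_arcs_successively: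
  "successively R xs \<Longrightarrow> (x, y) \<in> set (vwalk_arcs xs) \<Longrightarrow> R x y"
  by (induction xs rule: vwalk_arcs.induct) auto

lemma hamiltonian_with_projI:
  assumes c: "distinct c" "set c = pverts G" "length c \<ge> 3"
    and R: "successively R c" "R (last c) (hd c)"
    and arcs: "\<And>x y. x \<in> pverts G \<Longrightarrow> y \<in> pverts G \<Longrightarrow> R x y \<Longrightarrow> (x, y) \<in> parcs G"
  shows "hamiltonian (with_proj G)"
proof -
  have ne: "c \<noteq> []" using c(3) by auto
  define d where "d = c @ [hd c]"
  have d: "d \<noteq> []" "hd d = hd c" "last d = hd c" "set d = pverts G" "successively R d"
    using ne R c(2) by (auto simp: d_def successively_append_iff)
  have len: "length (vwalk_arcs d) = length c"
    by (simp add: length_vwalk_arcs d_def)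
  have verts: "pre_digraph.awalk_verts (with_proj G) (hd c) (vwalk_arcs d) = d"
    using vwalk_arcs_walk(2)[OF d(1)] d(2) by simp
  have "set (vwalk_arcs d) \<subseteq> parcs G"
  proof
    fix e assume "e \<in> set (vwalk_arcs d)"
    then show "e \<in> parcs G"
      using set_vwalk_arcs_successively[OF d(5)] arcs_in_vwalk_arcs[of e d] arcs d(4)
      by (cases e) auto
  qed
  then have walk: "pre_digraph.awalk (with_proj G) (hd c) (vwalk_arcs d) (hd c)"
    using vwalk_arcs_walk(1)[OF d(1), of G] d c(2) ne by (auto simp: pre_digraph.awalk_def)
  \<comment> \<open>A \<open>cycle\<close> lists its base vertex at both ends, so distinctness is
    required only of the tail.\<close>
  have "distinct (tl d)" using c(1) ne by (cases c) (auto simp: d_def)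
  moreover have "vwalk_arcs d \<noteq> []" using len ne by auto
  ultimately have "pre_digraph.cycle (with_proj G) (vwalk_arcs d)"
    unfolding pre_digraph.cycle_def using walk verts by auto
  then show ?thesis
    unfolding hamiltonian_def using walk verts len c(3) d(4)
    by (intro exI[of _ "hd c"] exI[of _ "vwalk_arcs d"]) simp
qed

theorem theorem15:
  fixes a b n :: nat
  assumes "a \<ge> 1" and "b \<ge> 1" and "even a" and "even b" and "n \<ge> 3"
  shows "hamiltonian (with_proj (horadam_cube a b n))"
proof -
  have pos: "a > 0" "b > 0" using assms by simp_all
  have linked: "\<exists>p q. linked_paths a b (Suc m) p q" for m
  proof (induction m)
    case 0
    show ?case using linked_paths_1 assms by simp
  next
    case (Suc m)
    then obtain p q where "linked_paths a b (Suc m) p q" by blast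
    then obtain c where "linked_paths a b (Suc (Suc m)) (rev q) c" "adj (last c) (hd c)"
        "length c \<ge> 3"
      by (rule linked_paths_step[OF assms(3) pos(1) assms(4) pos(2)])
    then show ?case by blast
  qed
  \<comment> \<open>The invariant alone does not say that the longer path closes up; the step says
    so of the path it builds. Hence one last step, from lengths \<open>m + 1\<close> and
    \<open>m + 2\<close> to \<open>n\<close>.\<close>
  obtain m where n: "n = Suc (Suc (Suc m))"
    using le_Suc_ex[OF assms(5)] by (auto simp: eval_nat_numeral)
  obtain p q where "linked_paths a b (Suc m) p q" using linked by blast
  then obtain c where c: "linked_paths a b (Suc (Suc m)) (rev q) c" "adj (last c) (hd c)"
      "length c \<ge> 3"
    by (rule linked_paths_step[OF assms(3) pos(1) assms(4) pos(2)])
  show ?thesis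
  proof (rule hamiltonian_with_projI[where R=adj])
    show "distinct c" "successively adj c" "set c = pverts (horadam_cube a b n)"
      using c(1) by (auto simp: linked_paths_def ham_path_def horadam_cube_def n)
    show "(x, y) \<in> parcs (horadam_cube a b n)"
      if "x \<in> pverts (horadam_cube a b n)" "y \<in> pverts (horadam_cube a b n)" "adj x y" for x y
      using that by (auto simp: horadam_cube_def adj_def horadam_strings_def)
  qed (rule c)+
qed

end
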